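(* Let $\xi$ be an extremal real number and let $\gamma=(1+\sqrt5)/2$. There exists a constant $c>0$ depending only on $\xi$ such that for any real number $X\ge 1$ the inequalities $$|x_0|\le X,\qquad |x_1|\le X,\qquad |x_0\xi^2+x_1\xi+x_2|\le cX^{-\gamma^2}$$ have a non-zero solution $(x_0,x_1,x_2)\in\mathbb{Z}^3$.
   Context: A real number $\xi$ is called extremal if it is neither rational nor quadratic irrational (i.e. not algebraic over $\mathbb{Q}$ of degree at most $2$) and there exists a constant $c'>0$ such that, for every real number $X\ge 1$, the inequalities $|x_0|\le X$, $|x_0\xi-x_1|\le c'X^{-1/\gamma}$, $|x_0\xi^2-x_2|\le c'X^{-1/\gamma}$ have a non-zero solution $(x_0,x_1,x_2)\in\mathbb{Z}^3$, where $\gamma=(1+\sqrt5)/2$. *)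

theory Defs
  imports Complex_Main "HOL-Computational_Algebra.Polynomial"
begin

definition golden_ratio :: real  (\<open>\<gamma>\<close>)
  where "golden_ratio = (1 + sqrt 5) / 2"

definition quadratic_irrational :: "real \<Rightarrow> bool" where
  "quadratic_irrational \<xi> \<longleftrightarrow>
     \<xi> \<notin> \<rat> \<and> (\<exists>p :: rat poly. degree p = 2 \<and> poly (map_poly of_rat p) \<xi> = 0)"

definition extremal :: "real \<Rightarrow> bool" where
  "extremal \<xi> \<longleftrightarrow> \<xi> \<notin> \<rat> \<and> \<not> quadratic_irrational \<xi> \<and>
     (\<exists>c' > 0. \<forall>X \<ge> 1 :: real. \<exists>x0 x1 x2 :: int. (x0, x1, x2) \<noteq> (0, 0, 0) \<and>
        \<bar>real_of_int x0\<bar> \<le> X \<and>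
        \<bar>real_of_int x0 * \<xi> - real_of_int x1\<bar> \<le> c' * X powr (- (1 / \<gamma>)) \<and>
        \<bar>real_of_int x0 * \<xi>\<^sup>2 - real_of_int x2\<bar> \<le> c' * X powr (- (1 / \<gamma>)))"

end

theory Submission
  imports Defs
begin

text \<open>
  Write \<open>v = (1, \<xi>, \<xi>\<^sup>2)\<close>. Extremality supplies, for every \<open>n\<close>, an integer point \<open>w n\<close> with first
  coordinate at most of order \<open>2\<^sup>n\<close> that lies within order \<open>2\<close> to the power \<open>-n/\<gamma>\<close> of the line
  spanned by \<open>v\<close>. The small values of \<open>x0 \<xi>\<^sup>2 + x1 \<xi> + x2\<close> come from duality: a plane that
  contains two such points almost contains \<open>v\<close>, so its primitive integer normal \<open>p\<close> is a linear form
  that is small at \<open>v\<close>. It divides the cross product of any two independent integer points of the plane,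
  and may therefore be estimated by different pairs of points for different purposes.

  Given \<open>n\<close>, take the plane spanned by \<open>w n\<close> and the next point of the sequence that differs from it,
  and follow the sequence in both directions for as long as it stays in this plane, say from index \<open>k\<close>
  to index \<open>l\<close>.

  At the lower end, the first two distinct points \<open>w k\<close> and \<open>w (i + 1)\<close> bound the coefficients of
  \<open>p\<close>. The point \<open>w k = w i\<close> is still good at level \<open>i\<close>, which cannot last long: the integer
  \<open>x0 x2 - x1\<^sup>2\<close> formed from \<open>w k\<close> is nonzero for large \<open>k\<close> (\<open>hankel_det_zero_bound\<close>) while its size is at most
  the first coordinate times the distance to the line. So \<open>2\<^sup>i\<close> is at most of order \<open>2\<close> to the power
  \<open>\<gamma> k\<close>, and the coefficients are of order at most \<open>2\<close> to the power \<open>k/\<gamma>\<close>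
  (\<open>normal_height_bound\<close>).

  At the upper end, the last two distinct points \<open>w j\<close> and \<open>w l\<close> bound the value of the form. Together
  with \<open>w (l + 1)\<close>, which is off the plane, they have a nonzero integer determinant; this forces \<open>2\<^sup>l\<close>
  to be at least of order \<open>2\<close> to the power \<open>\<gamma> j\<close>, and the value is of order at most \<open>2\<close>
  to the power \<open>-\<gamma> j\<close> (\<open>normal_form_bound\<close>).

  Since \<open>k \<le> n \<le> j\<close> here, both bounds may be read with \<open>n\<close> as exponent, and the substitution
  \<open>X = 2\<close> to the power \<open>n/\<gamma>\<close> turns \<open>2\<close> to the power \<open>-\<gamma> n\<close> into the power
  \<open>-\<gamma>\<^sup>2\<close> of \<open>X\<close>. In the formulas \<open>1/\<gamma>\<close> appears as \<open>\<gamma> - 1\<close>, so that all exponents are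
  linear in \<open>\<gamma>\<close> after reduction by \<open>\<gamma>\<^sup>2 = \<gamma> + 1\<close>.
\<close>

section \<open>Integer triples\<close>

type_synonym ivec = "int \<times> int \<times> int"

fun dot :: "ivec \<Rightarrow> ivec \<Rightarrow> int" where
  "dot (a0, a1, a2) (b0, b1, b2) = a0 * b0 + a1 * b1 + a2 * b2"

fun cross :: "ivec \<Rightarrow> ivec \<Rightarrow> ivec" where
  "cross (a0, a1, a2) (b0, b1, b2) = (a1 * b2 - a2 * b1, a2 * b0 - a0 * b2, a0 * b1 - a1 * b0)"

fun scale :: "int \<Rightarrow> ivec \<Rightarrow> ivec" where
  "scale t (a0, a1, a2) = (t * a0, t * a1, t * a2)"

text \<open>Having coprime coordinates, in the form in which it is used: a Bezout relation gives the scalar in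
  \<open>parallel_to_primitive\<close> directly.\<close>

definition primitive :: "ivec \<Rightarrow> bool" where
  "primitive p \<longleftrightarrow> (\<exists>u. dot u p = 1)"

lemma scale_zero: "scale 0 p = (0, 0, 0)"
  by (cases p) simp

lemma dot_scale: "dot (scale t p) x = t * dot p x"
  by (cases p, cases x) (simp add: algebra_simps)

lemma dot_cross_self: "dot (cross a b) a = 0" "dot (cross a b) b = 0"
  by (cases a, cases b, simp add: algebra_simps)+

lemma primitive_nonzero: "primitive p \<Longrightarrow> p \<noteq> (0, 0, 0)"
proof
  assume "primitive p" "p = (0, 0, 0)"
  then obtain u where "dot u (0, 0, 0) = 1" by (auto simp: primitive_def)
  then show False by (cases u) simp
qed

lemma exists_primitive_divisor:
  assumes "x \<noteq> (0, 0, 0)"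
  obtains g p where "primitive p" "g \<noteq> 0" "x = scale g p"
proof -
  obtain x0 x1 x2 where x: "x = (x0, x1, x2)" by (cases x) auto
  define g where "g = gcd x0 (gcd x1 x2)"
  obtain r s where rs: "r * x1 + s * x2 = gcd x1 x2" using bezout_int by blast
  obtain t u where tu: "t * x0 + u * gcd x1 x2 = g" unfolding g_def using bezout_int by blast
  have g0: "g \<noteq> 0" using assms x by (auto simp: g_def)
  have "g dvd x0" "g dvd x1" "g dvd x2"
    unfolding g_def by (auto intro: dvd_trans[OF gcd_dvd2])
  then obtain p0 p1 p2 where p: "x0 = g * p0" "x1 = g * p1" "x2 = g * p2"
    by (auto elim!: dvdE)
  have "g = t * (g * p0) + u * (r * (g * p1) + s * (g * p2))"
    using tu rs p by simp
  also have "\<dots> = g * (t * p0 + (u * r) * p1 + (u * s) * p2)" by (simp add: algebra_simps)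
  finally have "t * p0 + (u * r) * p1 + (u * s) * p2 = 1" using g0 by simp
  then have "dot (t, u * r, u * s) (p0, p1, p2) = 1" by simp
  then have "primitive (p0, p1, p2)" unfolding primitive_def by blast
  then show thesis using that[of "(p0, p1, p2)" g] g0 x p by simp
qed

lemma parallel_to_primitive:
  assumes "primitive p" "cross p q = (0, 0, 0)"
  obtains t where "q = scale t p"
proof -
  obtain u where u: "dot u p = 1" using assms by (auto simp: primitive_def)
  have "q = scale (dot u q) p"
  proof -
    obtain p0 p1 p2 where p: "p = (p0, p1, p2)" by (cases p) auto
    obtain q0 q1 q2 where q: "q = (q0, q1, q2)" by (cases q) auto
    obtain u0 u1 u2 where uu: "u = (u0, u1, u2)" by (cases u) auto
    have e: "p1 * q2 = p2 * q1" "p2 * q0 = p0 * q2" "p0 * q1 = p1 * q0"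
      using assms(2) p q by auto
    have d: "u0 * p0 + u1 * p1 + u2 * p2 = 1" using u p uu by simp
    have "q0 = (u0 * q0 + u1 * q1 + u2 * q2) * p0" using e d by algebra
    moreover have "q1 = (u0 * q0 + u1 * q1 + u2 * q2) * p1" using e d by algebra
    moreover have "q2 = (u0 * q0 + u1 * q1 + u2 * q2) * p2" using e d by algebra
    ultimately show ?thesis by (simp add: p q uu)
  qed
  then show thesis using that by blast
qed

text \<open>This is what lets one normal vector inherit estimates from every pair of points of its plane: a nonzero
  integer multiple only increases heights and values.\<close>

lemma cross_multiple_of_primitive_normal:
  assumes "primitive p" "dot p a = 0" "dot p b = 0"
  obtains t where "cross a b = scale t p"
proof -
  have "cross p (cross a b) = (0, 0, 0)"
  proof -
    obtain p0 p1 p2 where p: "p = (p0, p1, p2)" by (cases p) auto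
    obtain a0 a1 a2 where a: "a = (a0, a1, a2)" by (cases a) auto
    obtain b0 b1 b2 where b: "b = (b0, b1, b2)" by (cases b) auto
    have e: "p0 * a0 + p1 * a1 + p2 * a2 = 0" "p0 * b0 + p1 * b1 + p2 * b2 = 0"
      using assms p a b by auto
    have "p1 * (a0 * b1 - a1 * b0) - p2 * (a2 * b0 - a0 * b2) = 0" using e by algebra
    moreover have "p2 * (a1 * b2 - a2 * b1) - p0 * (a0 * b1 - a1 * b0) = 0" using e by algebra
    moreover have "p0 * (a2 * b0 - a0 * b2) - p1 * (a1 * b2 - a2 * b1) = 0" using e by algebra
    ultimately show ?thesis by (simp add: p a b)
  qed
  then show thesis using parallel_to_primitive[OF assms(1)] that by metis
qed

text \<open>Fixing the sign of the first coordinate makes \<open>=\<close> decide linear dependence, so that runs of parallel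
  points in a sequence are runs of equal points.\<close>

lemma parallel_primitives_eq:
  assumes "primitive a" "primitive b" "fst a > 0" "fst b > 0" "cross a b = (0, 0, 0)"
  shows "a = b"
proof -
  obtain t where t: "b = scale t a" using parallel_to_primitive assms by blast
  obtain u where u: "dot u b = 1" using assms by (auto simp: primitive_def)
  have "dot u b = t * dot u a" using t by (cases u; cases a) (simp add: algebra_simps)
  with u have "t dvd 1" by (metis dvd_triv_left)
  moreover have "t > 0"
    using t assms(3,4) by (cases a) (auto simp: zero_less_mult_iff)
  ultimately have "t = 1" by auto
  with t show ?thesis by (cases a) simp
qed

text \<open>By Cramer's rule, the determinant of \<open>a\<close>, \<open>b\<close>, \<open>d\<close> times \<open>p\<close> is a combination of the three
  vanishing products.\<close>

lemma orthogonal_to_three_eq_zero: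
  assumes "dot (cross a b) d \<noteq> 0" "dot p a = 0" "dot p b = 0" "dot p d = 0"
  shows "p = (0, 0, 0)"
proof -
  obtain p0 p1 p2 where p: "p = (p0, p1, p2)" by (cases p) auto
  obtain a0 a1 a2 where a: "a = (a0, a1, a2)" by (cases a) auto
  obtain b0 b1 b2 where b: "b = (b0, b1, b2)" by (cases b) auto
  obtain d0 d1 d2 where d: "d = (d0, d1, d2)" by (cases d) auto
  let ?D = "dot (cross a b) d"
  have e: "p0 * a0 + p1 * a1 + p2 * a2 = 0" "p0 * b0 + p1 * b1 + p2 * b2 = 0"
     "p0 * d0 + p1 * d1 + p2 * d2 = 0"
    using assms p a b d by auto
  have "?D * p0 = 0" "?D * p1 = 0" "?D * p2 = 0"
    unfolding a b d dot.simps cross.simps using e by algebra+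
  then show ?thesis using assms(1) p by simp
qed

section \<open>Approximation errors and heights\<close>

fun form :: "real \<Rightarrow> ivec \<Rightarrow> real" where
  "form \<xi> (p0, p1, p2) = p0 + p1 * \<xi> + p2 * \<xi>\<^sup>2"

text \<open>The distance of \<open>x\<close> from the line through \<open>(1, \<xi>, \<xi>\<^sup>2)\<close>, measured at the first coordinate
  of \<open>x\<close>.\<close>

fun err :: "real \<Rightarrow> ivec \<Rightarrow> real" where
  "err \<xi> (x0, x1, x2) = max \<bar>x0 * \<xi> - x1\<bar> \<bar>x0 * \<xi>\<^sup>2 - x2\<bar>"

text \<open>The constant coefficient is left out: it is determined up to the value of the form by the other two.\<close>

fun height :: "ivec \<Rightarrow> real" where
  "height (p0, p1, p2) = max \<bar>real_of_int p1\<bar> \<bar>real_of_int p2\<bar>"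

lemma err_nonneg: "err \<xi> x \<ge> 0"
  by (cases x) (simp add: le_max_iff_disj)

lemma height_nonneg: "height x \<ge> 0"
  by (cases x) (simp add: le_max_iff_disj)

lemma abs_mult_int_ge:
  fixes y :: real
  assumes "t \<noteq> (0 :: int)"
  shows "\<bar>y\<bar> \<le> \<bar>real_of_int t * y\<bar>"
proof -
  have "1 \<le> \<bar>real_of_int t\<bar>" using assms by linarith
  then have "1 * \<bar>y\<bar> \<le> \<bar>real_of_int t\<bar> * \<bar>y\<bar>" by (intro mult_right_mono) auto
  then show ?thesis by (simp add: abs_mult)
qed

lemma height_le_scale: "t \<noteq> 0 \<Longrightarrow> height p \<le> height (scale t p)"
  using abs_mult_int_ge[of t] by (cases p) (auto intro: max.mono simp del: max.bounded_iff)

lemma form_scale: "form \<xi> (scale t p) = t * form \<xi> p"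
  by (cases p) (simp add: algebra_simps)

lemma form_le_scale: "t \<noteq> 0 \<Longrightarrow> \<bar>form \<xi> p\<bar> \<le> \<bar>form \<xi> (scale t p)\<bar>"
  unfolding form_scale by (rule abs_mult_int_ge)

lemma err_le_scale: "t \<noteq> 0 \<Longrightarrow> err \<xi> p \<le> err \<xi> (scale t p)"
proof -
  assume t: "t \<noteq> 0"
  obtain p0 p1 p2 where p: "p = (p0, p1, p2)" by (cases p) auto
  show ?thesis
    unfolding p using abs_mult_int_ge[OF t, of "p0 * \<xi> - p1"] abs_mult_int_ge[OF t, of "p0 * \<xi>\<^sup>2 - p2"]
    by (auto intro!: max.mono simp: algebra_simps)
qed

text \<open>Expressing the last two coordinates through the first and the errors, the main terms of each
  coordinate of the cross product cancel.\<close>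

lemma height_cross:
  "height (cross a b) \<le> \<bar>real_of_int (fst a)\<bar> * err \<xi> b + \<bar>real_of_int (fst b)\<bar> * err \<xi> a"
proof -
  obtain a0 a1 a2 where a: "a = (a0, a1, a2)" by (cases a) auto
  obtain b0 b1 b2 where b: "b = (b0, b1, b2)" by (cases b) auto
  have *: "\<bar>real_of_int a0 * v - real_of_int b0 * u\<bar> \<le> \<bar>real_of_int a0\<bar> * err \<xi> b + \<bar>real_of_int b0\<bar> * err \<xi> a"
    if "\<bar>v\<bar> \<le> err \<xi> b" "\<bar>u\<bar> \<le> err \<xi> a" for u v :: real
  proof -
    have "\<bar>real_of_int a0 * v - real_of_int b0 * u\<bar> \<le> \<bar>real_of_int a0\<bar> * \<bar>v\<bar> + \<bar>real_of_int b0\<bar> * \<bar>u\<bar>"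
      using abs_triangle_ineq4[of "a0 * v" "b0 * u"] by (simp add: abs_mult)
    also have "\<dots> \<le> \<bar>real_of_int a0\<bar> * err \<xi> b + \<bar>real_of_int b0\<bar> * err \<xi> a"
      using that by (intro add_mono mult_mono) auto
    finally show ?thesis .
  qed
  have 2: "real_of_int (a0 * b1 - a1 * b0) = - (a0 * (b0 * \<xi> - b1) - b0 * (a0 * \<xi> - a1))"
    and 1: "real_of_int (a2 * b0 - a0 * b2) = a0 * (b0 * \<xi>\<^sup>2 - b2) - b0 * (a0 * \<xi>\<^sup>2 - a2)"
    by (simp_all add: algebra_simps)
  have "\<bar>real_of_int (a0 * b1 - a1 * b0)\<bar> \<le> \<bar>real_of_int a0\<bar> * err \<xi> b + \<bar>real_of_int b0\<bar> * err \<xi> a"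
    unfolding 2 abs_minus_cancel by (rule *) (simp_all add: a b)
  moreover have "\<bar>real_of_int (a2 * b0 - a0 * b2)\<bar> \<le> \<bar>real_of_int a0\<bar> * err \<xi> b + \<bar>real_of_int b0\<bar> * err \<xi> a"
    unfolding 1 by (rule *) (simp_all add: a b)
  ultimately show ?thesis by (simp add: a b del: of_int_diff of_int_mult err.simps)
qed

text \<open>The left-hand side is the determinant of \<open>(1, \<xi>, \<xi>\<^sup>2)\<close>, \<open>a\<close>, \<open>b\<close>. Subtracting multiples
  of the first row from the others leaves only the errors in them.\<close>

lemma form_cross: "\<bar>form \<xi> (cross a b)\<bar> \<le> 2 * err \<xi> a * err \<xi> b"
proof -
  obtain a0 a1 a2 where a: "a = (a0, a1, a2)" by (cases a) auto
  obtain b0 b1 b2 where b: "b = (b0, b1, b2)" by (cases b) auto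
  define u1 u2 v1 v2 where d: "u1 = a0 * \<xi> - a1" "u2 = a0 * \<xi>\<^sup>2 - a2"
    "v1 = b0 * \<xi> - b1" "v2 = b0 * \<xi>\<^sup>2 - b2"
  have "form \<xi> (cross a b) = u1 * v2 - u2 * v1"
    unfolding a b d by (simp add: algebra_simps power2_eq_square)
  moreover have "\<bar>u1 * v2 - u2 * v1\<bar> \<le> \<bar>u1\<bar> * \<bar>v2\<bar> + \<bar>u2\<bar> * \<bar>v1\<bar>"
    using abs_triangle_ineq4[of "u1 * v2" "u2 * v1"] by (simp add: abs_mult)
  moreover have "\<bar>u1\<bar> * \<bar>v2\<bar> + \<bar>u2\<bar> * \<bar>v1\<bar> \<le> err \<xi> a * err \<xi> b + err \<xi> a * err \<xi> b"
    by (intro add_mono mult_mono) (auto simp: a b d le_max_iff_disj)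
  ultimately show ?thesis by simp
qed

text \<open>Replacing \<open>x\<close> by the point of the line with the same first coordinate changes only the last two
  coordinates, and each by at most the error. With \<open>p\<close> a cross product this estimates a
  determinant.\<close>

lemma dot_near_form: "\<bar>real_of_int (dot p x) - real_of_int (fst x) * form \<xi> p\<bar> \<le> 2 * height p * err \<xi> x"
proof -
  obtain p0 p1 p2 where p: "p = (p0, p1, p2)" by (cases p) auto
  obtain x0 x1 x2 where x: "x = (x0, x1, x2)" by (cases x) auto
  have "real_of_int (dot p x) - real_of_int (fst x) * form \<xi> p = - (p1 * (x0 * \<xi> - x1) + p2 * (x0 * \<xi>\<^sup>2 - x2))"
    by (simp add: p x algebra_simps)
  also have "\<bar>\<dots>\<bar> \<le> \<bar>real_of_int p1\<bar> * \<bar>x0 * \<xi> - x1\<bar> + \<bar>real_of_int p2\<bar> * \<bar>x0 * \<xi>\<^sup>2 - x2\<bar>"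
    unfolding abs_minus_cancel
    using abs_triangle_ineq[of "p1 * (x0 * \<xi> - x1)" "p2 * (x0 * \<xi>\<^sup>2 - x2)"] by (simp add: abs_mult)
  also have "\<dots> \<le> height p * err \<xi> x + height p * err \<xi> x"
    by (intro add_mono mult_mono) (auto simp: p x le_max_iff_disj)
  finally show ?thesis by simp
qed

text \<open>The determinant of the symmetric matrix with rows \<open>(x0, x1)\<close> and \<open>(x1, x2)\<close>. It vanishes on the
  line through \<open>(1, \<xi>, \<xi>\<^sup>2)\<close>.\<close>

fun hankel_det :: "ivec \<Rightarrow> int" where
  "hankel_det (x0, x1, x2) = x0 * x2 - x1\<^sup>2"

lemma hankel_det_le:
  assumes "fst x > 0" "err \<xi> x \<le> c"
  shows "\<bar>real_of_int (hankel_det x)\<bar> \<le> (1 + 2 * \<bar>\<xi>\<bar> + c) * real_of_int (fst x) * err \<xi> x"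
proof -
  obtain x0 x1 x2 where x: "x = (x0, x1, x2)" by (cases x) auto
  define u1 u2 where d: "u1 = x0 * \<xi> - x1" "u2 = x0 * \<xi>\<^sup>2 - x2"
  have u: "\<bar>u1\<bar> \<le> err \<xi> x" "\<bar>u2\<bar> \<le> err \<xi> x" by (auto simp: x d)
  have x0: "real_of_int x0 \<ge> 1" using assms x by simp
  have e: "err \<xi> x \<ge> 0" by (rule err_nonneg)
  have "hankel_det x = - (x0 * u2) + 2 * \<xi> * x0 * u1 - u1 * u1"
    unfolding x d by (simp add: algebra_simps power2_eq_square)
  then have "\<bar>hankel_det x\<bar> \<le> \<bar>x0 * u2\<bar> + \<bar>2 * \<xi> * x0 * u1\<bar> + \<bar>u1 * u1\<bar>" by linarith
  also have "\<dots> = x0 * \<bar>u2\<bar> + 2 * \<bar>\<xi>\<bar> * x0 * \<bar>u1\<bar> + \<bar>u1\<bar> * \<bar>u1\<bar>"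
    using x0 by (simp add: abs_mult)
  also have "\<dots> \<le> x0 * err \<xi> x + 2 * \<bar>\<xi>\<bar> * x0 * err \<xi> x + (x0 * c) * err \<xi> x"
  proof (intro add_mono mult_left_mono mult_mono)
    have "1 * c \<le> x0 * c" using x0 e assms(2) by (intro mult_right_mono) auto
    then show "\<bar>u1\<bar> \<le> x0 * c" using u(1) assms(2) by linarith
  qed (use u x0 e assms(2) in auto)
  finally show ?thesis by (simp add: x algebra_simps)
qed

lemma hankel_det_zero_parametrization:
  assumes "x0 * x2 = (x1 :: int)\<^sup>2" "x0 > 0"
  obtains d q p where "d > 0" "q \<noteq> 0" "x0 = d * q\<^sup>2" "x1 = d * q * p" "x2 = d * p\<^sup>2"
proof -
  define g where "g = gcd x0 x1"
  have g: "g > 0" using assms(2) by (simp add: g_def)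
  obtain q p where qp: "x0 = q * g" "x1 = p * g" "coprime q p"
    using gcd_coprime_exists[of x0 x1] g unfolding g_def by auto
  have q0: "q > 0" using qp(1) assms(2) g by (simp add: zero_less_mult_iff)
  have "g * (q * x2) = g * (p * p * g)" using assms(1) qp by (simp add: power2_eq_square algebra_simps)
  then have e: "q * x2 = p * p * g" using g by simp
  have "coprime q (p * p)" using qp(3) by simp
  moreover have "q dvd p * p * g" using e by (metis dvd_triv_left)
  ultimately have "q dvd g" by (simp add: coprime_dvd_mult_right_iff)
  then obtain d where d: "g = q * d" by (auto elim: dvdE)
  have "d > 0" using d g q0 by (simp add: zero_less_mult_iff)
  moreover have "x2 = d * p\<^sup>2"
    using e d q0 by (simp add: power2_eq_square algebra_simps)
  ultimately show thesis
    using that[of d q p] q0 qp d by (simp add: power2_eq_square algebra_simps)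
qed

text \<open>If the determinant of \<open>x\<close> vanishes, then \<open>x = d (q\<^sup>2, q p, p\<^sup>2)\<close>. As \<open>y\<close> is not parallel to
  \<open>x\<close>, one of the integers \<open>q y1 - p y0\<close> and \<open>q y2 - p y1\<close> is nonzero. Both are at most of order
  \<open>\<bar>q\<bar> e\<close>, because \<open>y1/y0\<close>, \<open>y2/y1\<close> and \<open>p/q\<close> all approximate \<open>\<xi>\<close>, and \<open>q\<^sup>2\<close> is at
  most the first coordinate of \<open>x\<close>. Errors smaller than the power \<open>-1/2\<close> of that coordinate
  thus exclude this case, which is why \<open>1/\<gamma> > 1/2\<close> matters.\<close>

lemma hankel_det_zero_bound:
  assumes "primitive x" "primitive y" "fst y > 0" "fst y \<le> fst x" "x \<noteq> y" "hankel_det x = 0"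
    and e: "err \<xi> x \<le> e" "err \<xi> y \<le> e" "e \<le> c"
  shows "1 \<le> real_of_int (fst x) * ((2 + 2 * \<bar>\<xi>\<bar> + c) * e)\<^sup>2"
proof -
  obtain x0 x1 x2 where x: "x = (x0, x1, x2)" by (cases x) auto
  obtain y0 y1 y2 where y: "y = (y0, y1, y2)" by (cases y) auto
  have pos: "x0 > 0" "y0 > 0" "y0 \<le> x0" using assms x y by auto
  obtain d q p where p: "d > 0" "q \<noteq> 0" "x0 = d * q\<^sup>2" "x1 = d * q * p" "x2 = d * p\<^sup>2"
    using hankel_det_zero_parametrization[of x0 x2 x1] assms(6) pos x by auto
  define \<eta> where "\<eta> = q * \<xi> - p"
  define v1 v2 where v: "v1 = y0 * \<xi> - y1" "v2 = y0 * \<xi>\<^sup>2 - y2"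
  have ve: "\<bar>v1\<bar> \<le> e" "\<bar>v2\<bar> \<le> e" using e by (auto simp: y v)
  have e0: "e \<ge> 0" using err_nonneg[of \<xi> x] e by linarith
  have d1: "real_of_int d \<ge> 1" using p(1) by linarith
  have x0: "real_of_int x0 = d * (\<bar>real_of_int q\<bar> * \<bar>real_of_int q\<bar>)"
    using p(3) by (simp add: power2_eq_square)
  have "d * \<bar>real_of_int q\<bar> * \<bar>\<eta>\<bar> = \<bar>x0 * \<xi> - x1\<bar>"
  proof -
    have "x0 * \<xi> - x1 = d * q * \<eta>" by (simp add: p \<eta>_def algebra_simps power2_eq_square)
    then show ?thesis using p(1) by (simp add: abs_mult)
  qed
  also have "\<dots> \<le> e" using e(1) by (simp add: x)
  finally have \<eta>1: "d * \<bar>real_of_int q\<bar> * \<bar>\<eta>\<bar> \<le> e" .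
  \<comment> \<open>The ordering of the first coordinates enters here: it makes the defect of the slope \<open>p / q\<close>
     harmless even after multiplication by the first coordinate of \<open>y\<close>.\<close>
  have \<eta>2: "y0 * \<bar>\<eta>\<bar> \<le> \<bar>real_of_int q\<bar> * e"
  proof -
    have "y0 * \<bar>\<eta>\<bar> \<le> x0 * \<bar>\<eta>\<bar>" using pos by (intro mult_right_mono) auto
    also have "\<dots> = \<bar>real_of_int q\<bar> * (d * \<bar>real_of_int q\<bar> * \<bar>\<eta>\<bar>)" by (simp add: x0)
    also have "\<dots> \<le> \<bar>real_of_int q\<bar> * e" using \<eta>1 by (intro mult_left_mono) auto
    finally show ?thesis .
  qed
  have \<eta>3: "\<bar>\<eta>\<bar> \<le> \<bar>real_of_int q\<bar> * c"
  proof -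
    have "1 * \<bar>\<eta>\<bar> \<le> y0 * \<bar>\<eta>\<bar>" using pos by (intro mult_right_mono) auto
    also have "\<dots> \<le> \<bar>real_of_int q\<bar> * c"
      by (rule order_trans[OF \<eta>2]) (use e in \<open>auto intro: mult_left_mono\<close>)
    finally show ?thesis by simp
  qed
  have "real_of_int p = q * \<xi> - \<eta>" by (simp add: \<eta>_def)
  then have "\<bar>real_of_int p\<bar> \<le> \<bar>q * \<xi>\<bar> + \<bar>\<eta>\<bar>" by linarith
  then have pb: "\<bar>real_of_int p\<bar> \<le> \<bar>real_of_int q\<bar> * (\<bar>\<xi>\<bar> + c)"
    using \<eta>3 by (simp add: abs_mult algebra_simps)
  let ?M = "(2 + 2 * \<bar>\<xi>\<bar> + c) * e"
  have cc: "c \<ge> 0" using e0 e by linarith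
  have "\<bar>real_of_int (q * y1 - p * y0)\<bar> \<le> \<bar>real_of_int q\<bar> * ?M"
  proof -
    have "real_of_int (q * y1 - p * y0) = y0 * \<eta> - q * v1"
      by (simp add: \<eta>_def v algebra_simps)
    then have "\<bar>real_of_int (q * y1 - p * y0)\<bar> \<le> y0 * \<bar>\<eta>\<bar> + \<bar>real_of_int q\<bar> * \<bar>v1\<bar>"
      using abs_triangle_ineq4[of "y0 * \<eta>" "q * v1"] pos by (simp add: abs_mult)
    also have "\<dots> \<le> \<bar>real_of_int q\<bar> * e + \<bar>real_of_int q\<bar> * e"
      using \<eta>2 ve by (intro add_mono mult_left_mono) auto
    also have "\<dots> = \<bar>real_of_int q\<bar> * (2 * e)" by simp
    also have "\<dots> \<le> \<bar>real_of_int q\<bar> * ?M"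
      using e0 cc by (intro mult_left_mono mult_right_mono) auto
    finally show ?thesis .
  qed
  moreover have "\<bar>real_of_int (q * y2 - p * y1)\<bar> \<le> \<bar>real_of_int q\<bar> * ?M"
  proof -
    have "real_of_int (q * y2 - p * y1) = \<xi> * (y0 * \<eta>) - q * v2 + p * v1"
      by (simp add: \<eta>_def v algebra_simps power2_eq_square)
    then have "\<bar>real_of_int (q * y2 - p * y1)\<bar> \<le> \<bar>\<xi> * (y0 * \<eta>)\<bar> + \<bar>q * v2\<bar> + \<bar>p * v1\<bar>" by linarith
    also have "\<dots> = \<bar>\<xi>\<bar> * (y0 * \<bar>\<eta>\<bar>) + \<bar>real_of_int q\<bar> * \<bar>v2\<bar> + \<bar>real_of_int p\<bar> * \<bar>v1\<bar>"
      using pos by (simp add: abs_mult)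
    also have "\<dots> \<le> \<bar>\<xi>\<bar> * (\<bar>real_of_int q\<bar> * e) + \<bar>real_of_int q\<bar> * e
        + (\<bar>real_of_int q\<bar> * (\<bar>\<xi>\<bar> + c)) * e"
    proof (intro add_mono)
      show "\<bar>\<xi>\<bar> * (y0 * \<bar>\<eta>\<bar>) \<le> \<bar>\<xi>\<bar> * (\<bar>real_of_int q\<bar> * e)"
        using \<eta>2 by (intro mult_left_mono) auto
      show "\<bar>real_of_int q\<bar> * \<bar>v2\<bar> \<le> \<bar>real_of_int q\<bar> * e"
        using ve by (intro mult_left_mono) auto
      show "\<bar>real_of_int p\<bar> * \<bar>v1\<bar> \<le> (\<bar>real_of_int q\<bar> * (\<bar>\<xi>\<bar> + c)) * e"
        using ve pb cc by (intro mult_mono) auto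
    qed
    also have "\<dots> = \<bar>real_of_int q\<bar> * ((1 + 2 * \<bar>\<xi>\<bar> + c) * e)" by (simp add: algebra_simps)
    also have "\<dots> \<le> \<bar>real_of_int q\<bar> * ?M"
      using e0 by (intro mult_left_mono mult_right_mono) auto
    finally show ?thesis .
  qed
  moreover have "q * y1 - p * y0 \<noteq> 0 \<or> q * y2 - p * y1 \<noteq> 0"
  proof (rule ccontr)
    assume "\<not> ?thesis"
    then have h: "q * y1 = p * y0" "q * y2 = p * y1" by auto
    have h2: "q * (q * y2) = p * (p * y0)" using h by algebra
    have "q * (x1 * y2 - x2 * y1) = 0" "x2 * y0 - x0 * y2 = 0" "x0 * y1 - x1 * y0 = 0"
      unfolding p using h h2 by algebra+
    then have "cross x y = (0, 0, 0)" using p(2) by (simp add: x y)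
    then show False using parallel_primitives_eq[of x y] assms x y pos by auto
  qed
  then have "1 \<le> \<bar>real_of_int (q * y1 - p * y0)\<bar> \<or> 1 \<le> \<bar>real_of_int (q * y2 - p * y1)\<bar>"
    by linarith
  ultimately have "1 \<le> \<bar>real_of_int q\<bar> * ?M" by linarith
  then have "1\<^sup>2 \<le> (\<bar>real_of_int q\<bar> * ?M)\<^sup>2" by (intro power_mono) auto
  also have "\<dots> = 1 * \<bar>real_of_int q\<bar>\<^sup>2 * ?M\<^sup>2" by (simp add: power_mult_distrib)
  also have "\<dots> \<le> d * \<bar>real_of_int q\<bar>\<^sup>2 * ?M\<^sup>2"
    using d1 by (intro mult_right_mono) auto
  also have "\<dots> = fst x * ?M\<^sup>2" by (simp add: x p)
  finally show ?thesis by simp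
qed

section \<open>The golden ratio\<close>

lemma golden_ratio_square: "\<gamma> * \<gamma> = \<gamma> + 1"
  by (simp add: golden_ratio_def field_simps)

text \<open>This is \<open>1/\<gamma> > 1/2\<close>, the inequality that excludes vanishing Hankel determinants.\<close>

lemma golden_ratio_gt: "\<gamma> > 3 / 2"
proof -
  have "sqrt 5 > sqrt (2\<^sup>2)" by (subst real_sqrt_less_iff) simp
  then show ?thesis by (simp add: golden_ratio_def)
qed

lemma golden_ratio_inverse: "1 / \<gamma> = \<gamma> - 1"
  using golden_ratio_square golden_ratio_gt by (simp add: field_simps)

section \<open>Sequences of good approximations\<close>

lemma run_end:
  fixes n N :: nat
  assumes "P n" "n \<le> N" "\<not> P N"
  obtains m where "n \<le> m" "\<And>i. n \<le> i \<Longrightarrow> i \<le> m \<Longrightarrow> P i" "\<not> P (Suc m)"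
proof -
  define L where "L = (LEAST i. n \<le> i \<and> \<not> P i)"
  have L: "n \<le> L" "\<not> P L"
    using LeastI[of "\<lambda>i. n \<le> i \<and> \<not> P i" N] assms by (auto simp: L_def)
  have lt: "P i" if "n \<le> i" "i < L" for i
    using not_less_Least[of i "\<lambda>i. n \<le> i \<and> \<not> P i"] that by (auto simp: L_def)
  have "L \<noteq> n" using L assms by auto
  then show thesis using that[of "L - 1"] L lt by auto
qed

lemma run_start:
  fixes n N :: nat
  assumes "P n" "N \<le> n" "\<not> P N"
  obtains k where "N \<le> k" "k < n" "\<not> P k" "\<And>i. k < i \<Longrightarrow> i \<le> n \<Longrightarrow> P i"
proof -
  have fin: "finite {i. i \<le> n \<and> \<not> P i}" by simp
  define k where "k = Max {i. i \<le> n \<and> \<not> P i}"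
  have "k \<in> {i. i \<le> n \<and> \<not> P i}" unfolding k_def using assms by (intro Max_in[OF fin]) auto
  moreover have "N \<le> k" unfolding k_def using assms by (intro Max_ge[OF fin]) auto
  moreover have "P i" if "k < i" "i \<le> n" for i
  proof (rule ccontr)
    assume "\<not> P i"
    then have "i \<le> k" unfolding k_def using that by (intro Max_ge[OF fin]) auto
    then show False using that by simp
  qed
  moreover have "k \<noteq> n" using assms calculation by auto
  ultimately show thesis using that[of k] by auto
qed

lemma two_powr_neg_tendsto_zero:
  assumes "a > 0"
  shows "(\<lambda>n. C * 2 powr (- a * real n)) \<longlonglongrightarrow> 0"
proof -
  have "2 powr (- a) < (1 :: real)" using powr_less_mono[of "- a" 0 2] assms by simp
  then have "(\<lambda>n. (2 powr (- a)) ^ n) \<longlonglongrightarrow> (0 :: real)"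
    by (intro LIMSEQ_realpow_zero) auto
  moreover have "(2 powr (- a)) ^ n = 2 powr (- a * real n)" for n
    by (simp add: powr_powr flip: powr_realpow)
  ultimately show ?thesis using tendsto_mult_right_zero by auto
qed

text \<open>Indexing by dyadic levels, with repetition of points, takes the place of the usual sequence of minimal
  points. Of their minimality only \<open>fst_mono\<close> is kept, which supplies the ordering of first coordinates
  in \<open>hankel_det_zero_bound\<close>; it can be achieved by taking \<open>w n\<close> with smallest first coordinate
  among the admissible points at level \<open>n\<close>.\<close>

locale approximating_sequence =
  fixes \<xi> A c :: real and w :: "nat \<Rightarrow> ivec"
  assumes form_nonzero: "p \<noteq> (0, 0, 0) \<Longrightarrow> form \<xi> p \<noteq> 0"
    and A_pos: "A > 0" and c_pos: "c > 0"
    and primitive_w: "primitive (w n)"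
    and fst_pos: "fst (w n) > 0"
    and fst_le: "real_of_int (fst (w n)) \<le> A * 2 powr real n"
    and fst_mono: "fst (w n) \<le> fst (w (Suc n))"
    and err_le: "err \<xi> (w n) \<le> c * 2 powr (- (\<gamma> - 1) * real n)"
begin

lemma err_le_of_le:
  assumes "m \<le> n"
  shows "err \<xi> (w n) \<le> c * 2 powr (- (\<gamma> - 1) * real m)"
proof -
  have "(\<gamma> - 1) * real m \<le> (\<gamma> - 1) * real n"
    using assms golden_ratio_gt by (intro mult_left_mono) auto
  then have "c * 2 powr (- (\<gamma> - 1) * real n) \<le> c * 2 powr (- (\<gamma> - 1) * real m)"
    using c_pos by (intro mult_left_mono[OF powr_mono]) (auto simp only: mult_minus_left)
  then show ?thesis using err_le[of n] by linarith
qed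

lemma err_le_c: "err \<xi> (w n) \<le> c"
  using err_le_of_le[of 0 n] by simp

lemma cross_nonzero: "w i \<noteq> w j \<Longrightarrow> cross (w i) (w j) \<noteq> (0, 0, 0)"
  using parallel_primitives_eq primitive_w fst_pos by blast

text \<open>A fixed rational plane does not contain \<open>(1, \<xi>, \<xi>\<^sup>2)\<close>, whereas the points approach the line
  spanned by this vector.\<close>

lemma eventually_off_plane:
  assumes "p \<noteq> (0, 0, 0)"
  shows "eventually (\<lambda>n. dot p (w n) \<noteq> 0) sequentially"
proof -
  have "(\<lambda>n. (2 * height p * c) * 2 powr (- (\<gamma> - 1) * real n)) \<longlonglongrightarrow> 0"
    using golden_ratio_gt by (intro two_powr_neg_tendsto_zero) auto
  moreover have "\<bar>form \<xi> p\<bar> > 0" using form_nonzero[OF assms] by simp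
  ultimately have "eventually (\<lambda>n. (2 * height p * c) * 2 powr (- (\<gamma> - 1) * real n) < \<bar>form \<xi> p\<bar>) sequentially"
    by (rule order_tendstoD)
  then show ?thesis
  proof eventually_elim
    case (elim n)
    have "\<bar>real_of_int (dot p (w n)) - real_of_int (fst (w n)) * form \<xi> p\<bar> \<le> 2 * height p * err \<xi> (w n)"
      by (rule dot_near_form)
    also have "\<dots> \<le> 2 * height p * (c * 2 powr (- (\<gamma> - 1) * real n))"
      using height_nonneg[of p] err_le by (intro mult_left_mono) auto
    also have "\<dots> < \<bar>form \<xi> p\<bar>" using elim by (simp add: mult.assoc)
    also have "\<dots> \<le> \<bar>real_of_int (fst (w n)) * form \<xi> p\<bar>"
      using fst_pos[of n] by (intro abs_mult_int_ge) auto
    finally show ?case by auto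
  qed
qed

lemma next_change:
  obtains m where "n \<le> m" "\<And>i. n \<le> i \<Longrightarrow> i \<le> m \<Longrightarrow> w i = w n" "w (Suc m) \<noteq> w m"
proof -
  obtain a b d where abd: "w n = (a, b, d)" by (cases "w n") auto
  \<comment> \<open>Any nonzero vector orthogonal to \<open>w n\<close> shows that \<open>w n\<close> is not repeated forever.\<close>
  have "(b, - a, 0) \<noteq> (0, 0, 0 :: int)" using fst_pos[of n] abd by auto
  then obtain N where N: "\<And>i. i \<ge> N \<Longrightarrow> dot (b, - a, 0) (w i) \<noteq> 0"
    using eventually_off_plane unfolding eventually_sequentially by blast
  have "w (max n N) \<noteq> w n" using N[of "max n N"] abd by auto
  then obtain m where m: "n \<le> m" "\<And>i. n \<le> i \<Longrightarrow> i \<le> m \<Longrightarrow> w i = w n" "w (Suc m) \<noteq> w n"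
    by (rule run_end[of "\<lambda>i. w i = w n", OF refl max.cobounded1]) blast
  have "w m = w n" using m(1) m(2)[of m] by blast
  then show thesis by (intro that[of m]) (use m in metis)+
qed

text \<open>Let \<open>w j\<close> be the last point before index \<open>l\<close> that differs from \<open>w l\<close>. The cross product of the two
  has value of order at most \<open>2\<close> to the power \<open>-(j + l)/\<gamma>\<close>. Its product with
  \<open>w (l + 1)\<close> is a nonzero integer of order at most \<open>2\<close> to the power
  \<open>l - (j + l)/\<gamma> = (l/\<gamma> - j)/\<gamma>\<close>, which gives \<open>l/\<gamma> \<ge> j\<close> up to a constant and turns the first exponent into
  \<open>-(1/\<gamma> + 1) j = -\<gamma> j\<close>.\<close>

lemma normal_form_bound:
  assumes p: "primitive p" and ml: "m < l"
    and orth: "\<And>i. m \<le> i \<Longrightarrow> i \<le> l \<Longrightarrow> dot p (w i) = 0"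
    and off: "dot p (w (Suc l)) \<noteq> 0" and change: "w (Suc m) \<noteq> w m"
  shows "\<bar>form \<xi> p\<bar> \<le> 2 * c\<^sup>2 * (10 * A * c\<^sup>2) powr \<gamma> * 2 powr (- \<gamma> * real m)"
proof -
  have "\<exists>i. m \<le> i \<and> i \<le> l \<and> w i \<noteq> w l" 
  proof (cases "w m = w l")
    case True
    then show ?thesis using change ml by (intro exI[of _ "Suc m"]) auto
  qed (use ml in auto)
  then obtain i where i: "m \<le> i" "i \<le> l" "w i \<noteq> w l" by auto
  obtain j where j: "i \<le> j" "j < l" "w j \<noteq> w l" "\<And>i. j < i \<Longrightarrow> i \<le> l \<Longrightarrow> w i = w l"
    by (rule run_start[of "\<lambda>i. w i = w l" l i]) (use i in blast)+
  have mj: "m \<le> j" using i(1) j(1) by simp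
  have wl: "w l = w (Suc j)" using j(4)[of "Suc j"] j(2) by simp
  define \<alpha> where "\<alpha> = 2 powr (- (\<gamma> - 1) * real j)"
  define \<beta> where "\<beta> = 2 powr (- (\<gamma> - 1) * real l)"
  define J where "J = 2 powr real j"
  define N where "N = 2 powr real l"
  note pos = A_pos c_pos
  have ab: "\<beta> \<le> \<alpha>" "J \<le> N" "\<alpha> > 0" "\<beta> > 0" "J > 0" "N > 0"
    using j(2) golden_ratio_gt by (auto simp: \<alpha>_def \<beta>_def J_def N_def)
  have fa: "real_of_int (fst (w j)) \<le> A * J" using fst_le[of j] by (simp add: J_def)
  have fb: "real_of_int (fst (w l)) \<le> 2 * A * J"
    using fst_le[of "Suc j"] by (simp add: J_def wl powr_add mult_ac)
  have fd: "real_of_int (fst (w (Suc l))) \<le> 2 * A * N"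
    using fst_le[of "Suc l"] by (simp add: N_def powr_add mult_ac)
  have ea: "err \<xi> (w j) \<le> c * \<alpha>" using err_le[of j] by (simp add: \<alpha>_def)
  have eb: "err \<xi> (w l) \<le> c * \<beta>" using err_le[of l] by (simp add: \<beta>_def)
  have ed: "err \<xi> (w (Suc l)) \<le> c * \<beta>" using err_le_of_le[of l "Suc l"] by (simp add: \<beta>_def)
  let ?y = "cross (w j) (w l)"
  obtain t where t: "?y = scale t p"
    using cross_multiple_of_primitive_normal[OF p] orth mj j ml
    by (meson le_trans less_imp_le order_refl)
  have t0: "t \<noteq> 0" using cross_nonzero[OF j(3)] t scale_zero by metis
  have f: "\<bar>form \<xi> ?y\<bar> \<le> 2 * c\<^sup>2 * (\<alpha> * \<beta>)"
  proof -
    have "\<bar>form \<xi> ?y\<bar> \<le> 2 * err \<xi> (w j) * err \<xi> (w l)" by (rule form_cross)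
    also have "\<dots> \<le> 2 * (c * \<alpha>) * (c * \<beta>)"
      using ea eb err_nonneg pos ab by (intro mult_mono) auto
    finally show ?thesis by (simp add: power2_eq_square mult_ac)
  qed
  have h: "height ?y \<le> 3 * A * c * (N * \<alpha>)"
  proof -
    have "height ?y \<le> \<bar>real_of_int (fst (w j))\<bar> * err \<xi> (w l) + \<bar>real_of_int (fst (w l))\<bar> * err \<xi> (w j)"
      by (rule height_cross)
    also have "\<dots> \<le> (A * J) * (c * \<alpha>) + (2 * A * J) * (c * \<alpha>)"
    proof (intro add_mono mult_mono)
      show "err \<xi> (w l) \<le> c * \<alpha>" using eb mult_left_mono[OF ab(1), of c] pos by linarith
    qed (use fa fb ea err_nonneg fst_pos[of j] fst_pos[of l] pos ab in auto)
    also have "\<dots> = 3 * A * c * (J * \<alpha>)" by (simp add: algebra_simps)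
    also have "\<dots> \<le> 3 * A * c * (N * \<alpha>)"
      using pos ab by (intro mult_left_mono mult_right_mono) auto
    finally show ?thesis .
  qed
  have "dot ?y (w (Suc l)) \<noteq> 0" using t t0 off by (simp add: dot_scale)
  then have "1 \<le> \<bar>real_of_int (dot ?y (w (Suc l)))\<bar>" by linarith
  also have "\<dots> \<le> \<bar>real_of_int (fst (w (Suc l))) * form \<xi> ?y\<bar> + 2 * height ?y * err \<xi> (w (Suc l))"
    using dot_near_form[of ?y "w (Suc l)" \<xi>] by linarith
  also have "\<dots> \<le> (2 * A * N) * (2 * c\<^sup>2 * (\<alpha> * \<beta>)) + 2 * (3 * A * c * (N * \<alpha>)) * (c * \<beta>)"
    unfolding abs_mult
    using fd f h ed fst_pos[of "Suc l"] err_nonneg height_nonneg pos ab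
    by (intro add_mono mult_mono) auto
  also have "\<dots> = (10 * A * c\<^sup>2) * (N * \<alpha> * \<beta>)" by (simp add: algebra_simps power2_eq_square)
  finally have 1: "1 \<le> (10 * A * c\<^sup>2) * (N * \<alpha> * \<beta>)" .
  define D where "D = 10 * A * c\<^sup>2"
  have D: "D > 0" using pos by (simp add: D_def)
  \<comment> \<open>Raising to the power \<open>\<gamma>\<close> normalises the coefficient of \<open>j\<close>, since \<open>(\<gamma> - 1) \<gamma> = 1\<close>.\<close>
  have "1 powr \<gamma> \<le> (D * (N * \<alpha> * \<beta>)) powr \<gamma>"
    using 1 golden_ratio_gt by (intro powr_mono2) (auto simp: D_def)
  also have "\<dots> = D powr \<gamma> * (N * \<alpha> * \<beta>) powr \<gamma>"
    by (rule powr_mult)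
  also have "(N * \<alpha> * \<beta>) powr \<gamma> = 2 powr ((real l - (\<gamma> - 1) * real j - (\<gamma> - 1) * real l) * \<gamma>)"
    by (simp add: N_def \<alpha>_def \<beta>_def powr_powr flip: powr_add) (simp add: algebra_simps)
  also have "(real l - (\<gamma> - 1) * real j - (\<gamma> - 1) * real l) * \<gamma> = (\<gamma> - 1) * real l - real j"
    using golden_ratio_square by algebra
  also have "D powr \<gamma> * 2 powr ((\<gamma> - 1) * real l - real j) = D powr \<gamma> * 2 powr (- real j) / \<beta>"
    by (simp add: \<beta>_def powr_diff powr_minus powr_add field_simps)
  finally have \<beta>2: "\<beta> \<le> D powr \<gamma> * 2 powr (- real j)"
    using ab by (simp add: field_simps)
  have "\<bar>form \<xi> p\<bar> \<le> \<bar>form \<xi> ?y\<bar>" unfolding t by (rule form_le_scale[OF t0])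
  also have "\<dots> \<le> 2 * c\<^sup>2 * (\<alpha> * \<beta>)" by (rule f)
  also have "\<dots> \<le> 2 * c\<^sup>2 * (\<alpha> * (D powr \<gamma> * 2 powr (- real j)))"
    using \<beta>2 ab by (intro mult_left_mono) auto
  also have "\<alpha> * (D powr \<gamma> * 2 powr (- real j)) = D powr \<gamma> * (\<alpha> * 2 powr (- real j))"
    by simp
  also have "\<alpha> * 2 powr (- real j) = 2 powr (- \<gamma> * real j)"
    by (simp add: \<alpha>_def algebra_simps flip: powr_add)
  also have "2 * c\<^sup>2 * (D powr \<gamma> * 2 powr (- \<gamma> * real j)) \<le> 2 * c\<^sup>2 * (D powr \<gamma> * 2 powr (- \<gamma> * real m))"
    using mj golden_ratio_gt by (intro mult_left_mono[OF mult_left_mono[OF powr_mono]]) auto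
  finally show ?thesis by (simp add: D_def mult.assoc)
qed

text \<open>The bound of \<open>hankel_det_zero_bound\<close> for two consecutive distinct points is of order \<open>2\<close> to the
  power \<open>k (1 - 2/\<gamma>) = -(2 \<gamma> - 3) k\<close>, which tends to zero.\<close>

lemma eventually_hankel_det_nonzero:
  "eventually (\<lambda>k. w (Suc k) \<noteq> w k \<longrightarrow> hankel_det (w (Suc k)) \<noteq> 0) sequentially"
proof -
  define M where "M = (2 + 2 * \<bar>\<xi>\<bar> + c) * c"
  have "(\<lambda>k. (A * 2 * M\<^sup>2) * 2 powr (- (2 * \<gamma> - 3) * real k)) \<longlonglongrightarrow> 0"
    using golden_ratio_gt by (intro two_powr_neg_tendsto_zero) auto
  then have "eventually (\<lambda>k. (A * 2 * M\<^sup>2) * 2 powr (- (2 * \<gamma> - 3) * real k) < 1) sequentially"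
    by (rule order_tendstoD) simp
  then show ?thesis
  proof eventually_elim
    case (elim k)
    show ?case
    proof (intro impI notI)
      assume ne: "w (Suc k) \<noteq> w k" and z: "hankel_det (w (Suc k)) = 0"
      define e where "e = c * 2 powr (- (\<gamma> - 1) * real k)"
      have "e \<le> c * 2 powr 0"
        unfolding e_def using c_pos golden_ratio_gt
        by (intro mult_left_mono[OF powr_mono] mult_nonpos_nonneg) auto
      then have "1 \<le> fst (w (Suc k)) * ((2 + 2 * \<bar>\<xi>\<bar> + c) * e)\<^sup>2"
        using err_le[of k] err_le_of_le[of k "Suc k"]
        by (intro hankel_det_zero_bound[OF primitive_w primitive_w fst_pos fst_mono ne z]) (auto simp: e_def)
      also have "\<dots> \<le> (A * 2 * 2 powr real k) * ((2 + 2 * \<bar>\<xi>\<bar> + c) * e)\<^sup>2"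
        using fst_le[of "Suc k"] by (intro mult_right_mono) (auto simp: powr_add mult_ac)
      also have "\<dots> = (A * 2 * M\<^sup>2) * (2 powr real k * (2 powr (- (\<gamma> - 1) * real k))\<^sup>2)"
        by (simp add: M_def e_def power_mult_distrib)
      also have "2 powr real k * (2 powr (- (\<gamma> - 1) * real k))\<^sup>2 = 2 powr (- (2 * \<gamma> - 3) * real k)"
        by (simp add: power2_eq_square flip: powr_add) (simp add: algebra_simps)
      finally show False using elim by simp
    qed
  qed
qed

text \<open>Let \<open>w (j + 1)\<close> be the first point after \<open>w k\<close> that differs from it. As \<open>w k = w j\<close>, its error is
  of order at most \<open>2\<close> to the power \<open>-j/\<gamma>\<close>, so the cross product of both has height of
  order at most \<open>2\<close> to the power \<open>j - j/\<gamma>\<close>, and the nonzero integer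
  \<open>hankel_det (w k)\<close> gives \<open>j/\<gamma> \<le> k\<close> up to a constant. Now
  \<open>j - j/\<gamma> = (j/\<gamma>)/\<gamma> \<le> k/\<gamma>\<close>.\<close>

lemma normal_height_bound:
  assumes p: "primitive p" and km: "k \<le> m"
    and orth: "\<And>i. k \<le> i \<Longrightarrow> i \<le> Suc m \<Longrightarrow> dot p (w i) = 0"
    and hankel_det: "hankel_det (w k) \<noteq> 0" and change: "w (Suc m) \<noteq> w m"
  shows "height p \<le> 3 * A * c * ((1 + 2 * \<bar>\<xi>\<bar> + c) * A * c) powr (\<gamma> - 1) * 2 powr ((\<gamma> - 1) * real k)"
proof -
  have "\<exists>i. k \<le> i \<and> i \<le> Suc m \<and> w i \<noteq> w k"
  proof (cases "w m = w k")
    case True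
    then show ?thesis using change km by (intro exI[of _ "Suc m"]) auto
  qed (use km in auto)
  then obtain i where i: "k \<le> i" "i \<le> Suc m" "w i \<noteq> w k" by auto
  obtain j where j: "k \<le> j" "\<And>i. k \<le> i \<Longrightarrow> i \<le> j \<Longrightarrow> w i = w k" "w (Suc j) \<noteq> w k"
    by (rule run_end[of "\<lambda>i. w i = w k" k i]) (use i in blast)+
  have jm: "j \<le> m"
  proof (rule ccontr)
    assume "\<not> j \<le> m"
    then show False using j(2)[of i] i by simp
  qed
  have wk: "w k = w j" using j(2)[of j] j(1) by simp
  define \<alpha> where "\<alpha> = 2 powr (- (\<gamma> - 1) * real j)"
  define J where "J = 2 powr real j"
  note pos = A_pos c_pos
  have ab: "\<alpha> > 0" "J > 0" by (auto simp: \<alpha>_def J_def)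
  have fa: "real_of_int (fst (w k)) \<le> A * J" using fst_le[of j] by (simp add: J_def wk)
  have fb: "real_of_int (fst (w (Suc j))) \<le> 2 * A * J"
    using fst_le[of "Suc j"] by (simp add: J_def powr_add mult_ac)
  have ea: "err \<xi> (w k) \<le> c * \<alpha>" using err_le[of j] by (simp add: \<alpha>_def wk)
  have eb: "err \<xi> (w (Suc j)) \<le> c * \<alpha>" using err_le_of_le[of j "Suc j"] by (simp add: \<alpha>_def)
  let ?y = "cross (w k) (w (Suc j))"
  obtain t where t: "?y = scale t p"
    using cross_multiple_of_primitive_normal[OF p orth[of k] orth[of "Suc j"]] j(1) km jm by auto
  have t0: "t \<noteq> 0" using cross_nonzero j(3) t scale_zero by metis
  have "height p \<le> height ?y" unfolding t by (rule height_le_scale[OF t0])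
  also have "\<dots> \<le> \<bar>real_of_int (fst (w k))\<bar> * err \<xi> (w (Suc j)) + \<bar>real_of_int (fst (w (Suc j)))\<bar> * err \<xi> (w k)"
    by (rule height_cross)
  also have "\<dots> \<le> (A * J) * (c * \<alpha>) + (2 * A * J) * (c * \<alpha>)"
    using fa fb ea eb err_nonneg fst_pos[of k] fst_pos[of "Suc j"] pos ab
    by (intro add_mono mult_mono) auto
  also have "\<dots> = 3 * A * c * (J * \<alpha>)" by (simp add: algebra_simps)
  finally have h: "height p \<le> 3 * A * c * (J * \<alpha>)" .
  define D where "D = (1 + 2 * \<bar>\<xi>\<bar> + c) * A * c"
  have D: "D > 0" using pos by (simp add: D_def)
  have "1 \<le> \<bar>real_of_int (hankel_det (w k))\<bar>" using hankel_det by linarith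
  also have "\<dots> \<le> (1 + 2 * \<bar>\<xi>\<bar> + c) * real_of_int (fst (w k)) * err \<xi> (w k)"
    by (rule hankel_det_le[OF fst_pos err_le_c])
  also have "\<dots> \<le> (1 + 2 * \<bar>\<xi>\<bar> + c) * (A * 2 powr real k) * (c * \<alpha>)"
    using ea err_nonneg fst_pos[of k] fst_le[of k] pos by (intro mult_mono) auto
  also have "\<dots> = D * (2 powr real k * \<alpha>)" by (simp add: D_def mult_ac)
  finally have "1 powr (\<gamma> - 1) \<le> (D * (2 powr real k * \<alpha>)) powr (\<gamma> - 1)"
    using golden_ratio_gt by (intro powr_mono2) auto
  also have "\<dots> = D powr (\<gamma> - 1) * (2 powr real k * \<alpha>) powr (\<gamma> - 1)"
    by (rule powr_mult)
  also have "(2 powr real k * \<alpha>) powr (\<gamma> - 1) = 2 powr ((real k - (\<gamma> - 1) * real j) * (\<gamma> - 1))"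
    by (simp add: \<alpha>_def powr_powr flip: powr_add) (simp add: algebra_simps)
  also have "(real k - (\<gamma> - 1) * real j) * (\<gamma> - 1) = (\<gamma> - 1) * real k - (2 - \<gamma>) * real j"
    using golden_ratio_square by algebra
  also have "2 powr ((\<gamma> - 1) * real k - (2 - \<gamma>) * real j) = 2 powr ((\<gamma> - 1) * real k) / (J * \<alpha>)"
    by (simp add: J_def \<alpha>_def algebra_simps flip: powr_add powr_diff)
  finally have "J * \<alpha> \<le> D powr (\<gamma> - 1) * 2 powr ((\<gamma> - 1) * real k)"
    using ab by (simp add: field_simps)
  then have "3 * A * c * (J * \<alpha>) \<le> 3 * A * c * (D powr (\<gamma> - 1) * 2 powr ((\<gamma> - 1) * real k))"
    using pos by (intro mult_left_mono) auto
  then show ?thesis using h by (simp add: D_def mult.assoc)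
qed

text \<open>For large \<open>n\<close> the run of points in the plane has both ends, and the lower one is so late that the
  Hankel determinant there is nonzero: three independent points of the sequence occur between the threshold of
  \<open>eventually_hankel_det_nonzero\<close> and \<open>n\<close>, and no plane contains them all.\<close>

lemma small_forms_dyadic:
  obtains K n0 where "K > 0"
    "\<And>n. n \<ge> n0 \<Longrightarrow> \<exists>p. p \<noteq> (0, 0, 0) \<and> height p \<le> K * 2 powr ((\<gamma> - 1) * real n)
        \<and> \<bar>form \<xi> p\<bar> \<le> K * 2 powr (- \<gamma> * real n)"
proof -
  define K1 where "K1 = 2 * c\<^sup>2 * (10 * A * c\<^sup>2) powr \<gamma>"
  define K2 where "K2 = 3 * A * c * ((1 + 2 * \<bar>\<xi>\<bar> + c) * A * c) powr (\<gamma> - 1)"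
  define K where "K = max 1 (max K1 K2)"
  obtain k0 where k0: "\<And>k. k \<ge> k0 \<Longrightarrow> w (Suc k) \<noteq> w k \<Longrightarrow> hankel_det (w (Suc k)) \<noteq> 0"
    using eventually_hankel_det_nonzero unfolding eventually_sequentially by blast
  obtain k1 where k1: "k0 \<le> k1" "w (Suc k1) \<noteq> w k1" using next_change by blast
  obtain k2 where k2: "\<And>i. i \<ge> k2 \<Longrightarrow> dot (cross (w k1) (w (Suc k1))) (w i) \<noteq> 0"
    using eventually_off_plane[OF cross_nonzero] k1(2) unfolding eventually_sequentially by metis
  define n0 where "n0 = max (Suc k1) k2"
  have "\<exists>p. p \<noteq> (0, 0, 0) \<and> height p \<le> K * 2 powr ((\<gamma> - 1) * real n)
        \<and> \<bar>form \<xi> p\<bar> \<le> K * 2 powr (- \<gamma> * real n)" if n: "n \<ge> n0" for n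
  proof -
    obtain m where m: "n \<le> m" "\<And>i. n \<le> i \<Longrightarrow> i \<le> m \<Longrightarrow> w i = w n" "w (Suc m) \<noteq> w m"
      using next_change by blast
    have y: "cross (w m) (w (Suc m)) \<noteq> (0, 0, 0)" using cross_nonzero m(3) by metis
    obtain g p where gp: "primitive p" "g \<noteq> 0" "cross (w m) (w (Suc m)) = scale g p"
      using exists_primitive_divisor[OF y] by blast
    have on: "dot p (w m) = 0" "dot p (w (Suc m)) = 0"
      using dot_cross_self[of "w m" "w (Suc m)"] gp(2,3) by (auto simp: dot_scale)
    have p0: "p \<noteq> (0, 0, 0)" using primitive_nonzero gp by blast
    have onn: "dot p (w i) = 0" if "n \<le> i" "i \<le> Suc m" for i
      using on m that by (cases "i = Suc m") (metis le_Suc_eq order_refl)+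
    have "\<exists>i. k0 \<le> i \<and> i \<le> n \<and> dot p (w i) \<noteq> 0"
    proof (rule ccontr)
      assume "\<not> ?thesis"
      then have "dot p (w k1) = 0" "dot p (w (Suc k1)) = 0" "dot p (w n) = 0"
        using k1 n by (auto simp: n0_def)
      moreover have "dot (cross (w k1) (w (Suc k1))) (w n) \<noteq> 0" using k2 n by (simp add: n0_def)
      ultimately show False using orthogonal_to_three_eq_zero p0 by blast
    qed
    then obtain i where i: "k0 \<le> i" "i \<le> n" "dot p (w i) \<noteq> 0" by blast
    obtain k where k: "i \<le> k" "k < n" "dot p (w k) \<noteq> 0" "\<And>i. k < i \<Longrightarrow> i \<le> n \<Longrightarrow> dot p (w i) = 0"
      by (rule run_start[of "\<lambda>i. dot p (w i) = 0" n i]) (use i onn[of n] m(1) in auto)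
    have "dot p (w (Suc k)) = 0" using k by auto
    then have "w (Suc k) \<noteq> w k" using k(3) by auto
    then have "hankel_det (w (Suc k)) \<noteq> 0" using k0 i k by auto
    moreover have "dot p (w i) = 0" if "Suc k \<le> i" "i \<le> Suc m" for i
      using k(4)[of i] onn[of i] that by (cases "i \<le> n") auto
    ultimately have "height p \<le> K2 * 2 powr ((\<gamma> - 1) * real (Suc k))"
      unfolding K2_def using k(2) m(1,3) by (intro normal_height_bound[of p "Suc k" m] gp) auto
    also have "\<dots> \<le> K * 2 powr ((\<gamma> - 1) * real n)"
      using k(2) golden_ratio_gt by (intro mult_mono powr_mono mult_left_mono) (auto simp: K_def)
    finally have h: "height p \<le> K * 2 powr ((\<gamma> - 1) * real n)" .
    obtain N where N: "\<And>i. i \<ge> N \<Longrightarrow> dot p (w i) \<noteq> 0"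
      using eventually_off_plane[OF p0] unfolding eventually_sequentially by blast
    obtain l where l: "Suc m \<le> l" "\<And>i. Suc m \<le> i \<Longrightarrow> i \<le> l \<Longrightarrow> dot p (w i) = 0" "dot p (w (Suc l)) \<noteq> 0"
      by (rule run_end[of "\<lambda>i. dot p (w i) = 0" "Suc m" "max (Suc m) N"]) (use on N in auto)
    have "dot p (w i) = 0" if "m \<le> i" "i \<le> l" for i
      using l(2)[of i] on that by (cases "i = m") auto
    then have "\<bar>form \<xi> p\<bar> \<le> K1 * 2 powr (- \<gamma> * real m)"
      unfolding K1_def using l(1,3) m(3) by (intro normal_form_bound[of p m l] gp) auto
    also have "\<dots> \<le> K * 2 powr (- \<gamma> * real n)"
      using m(1) golden_ratio_gt by (intro mult_mono[OF _ powr_mono]) (auto simp: K_def)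
    finally show ?thesis using h p0 by blast
  qed
  moreover have "K > 0" by (simp add: K_def)
  ultimately show thesis using that by blast
qed

end

section \<open>Extremal numbers\<close>

lemma form_nonzero_of_extremal:
  assumes "extremal \<xi>" "p \<noteq> (0, 0, 0)"
  shows "form \<xi> p \<noteq> 0"
proof
  assume z: "form \<xi> p = 0"
  obtain p0 p1 p2 where p: "p = (p0, p1, p2)" by (cases p) auto
  have irr: "\<xi> \<notin> \<rat>" "\<not> quadratic_irrational \<xi>" using assms(1) by (auto simp: extremal_def)
  have e: "p0 + p1 * \<xi> + p2 * \<xi>\<^sup>2 = 0" using z p by simp
  show False
  proof (cases "p2 = 0")
    case False
    let ?q = "[:of_int p0, of_int p1, of_int p2:] :: rat poly"
    have "degree ?q = 2" using False by simp
    moreover have "poly (map_poly of_rat ?q) \<xi> = 0"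
      using e False by (simp add: map_poly_pCons power2_eq_square algebra_simps)
    ultimately show False using irr unfolding quadratic_irrational_def by blast
  next
    case True
    then have "p1 \<noteq> 0" using e assms(2) p by auto
    then have "\<xi> = of_int (- p0) / of_int p1" using e True by (simp add: field_simps)
    moreover have "(of_int (- p0) / of_int p1 :: real) \<in> \<rat>" by (intro Rats_divide Rats_of_int)
    ultimately show False using irr(1) by simp
  qed
qed

text \<open>Past a certain level \<open>n0\<close> the errors are less than 1, which forces the first coordinate of a solution
  to be nonzero. Starting there, every solution can be replaced by a primitive one with positive first coordinate;
  the minimal first coordinate over these sets, which shrink as the level grows, is nondecreasing.\<close>

lemma extremal_imp_approximating_sequence:
  assumes "extremal \<xi>"
  obtains A c w where "approximating_sequence \<xi> A c w"
proof -
  obtain c where c: "c > 0" and sol: "\<And>X :: real. X \<ge> 1 \<Longrightarrow> \<exists>x0 x1 x2 :: int.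
        (x0, x1, x2) \<noteq> (0, 0, 0) \<and> \<bar>real_of_int x0\<bar> \<le> X \<and>
        \<bar>real_of_int x0 * \<xi> - real_of_int x1\<bar> \<le> c * X powr (- (1 / \<gamma>)) \<and>
        \<bar>real_of_int x0 * \<xi>\<^sup>2 - real_of_int x2\<bar> \<le> c * X powr (- (1 / \<gamma>))"
    using assms unfolding extremal_def by blast
  define e where "e n = c * 2 powr (- (\<gamma> - 1) * real n)" for n :: nat
  have e_mono: "e n \<le> e m" if "m \<le> n" for m n
  proof -
    have "(\<gamma> - 1) * real m \<le> (\<gamma> - 1) * real n"
      using that golden_ratio_gt by (intro mult_left_mono) auto
    then show ?thesis
      unfolding e_def using c by (intro mult_left_mono[OF powr_mono]) (auto simp only: mult_minus_left)
  qed
  have "e \<longlonglongrightarrow> 0" unfolding e_def using golden_ratio_gt by (intro two_powr_neg_tendsto_zero) auto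
  then have "eventually (\<lambda>n. e n < 1) sequentially" by (rule order_tendstoD) simp
  then obtain n0 where n0: "\<And>n. n \<ge> n0 \<Longrightarrow> e n < 1" unfolding eventually_sequentially by blast
  define S where "S n x \<longleftrightarrow> primitive x \<and> fst x > 0 \<and> err \<xi> x \<le> e (n0 + n)" for n x
  define w where "w n = arg_min (\<lambda>x. nat (fst x)) (S n)" for n
  have ex: "\<exists>x. S n x \<and> real_of_int (fst x) \<le> 2 powr real (n0 + n)" for n
  proof -
    define X where "X = 2 powr real (n0 + n)"
    have "X \<ge> 1" unfolding X_def by (rule ge_one_powr_ge_zero) auto
    then obtain x0 x1 x2 :: int where x: "(x0, x1, x2) \<noteq> (0, 0, 0)" "\<bar>real_of_int x0\<bar> \<le> X"
        "\<bar>real_of_int x0 * \<xi> - real_of_int x1\<bar> \<le> c * X powr (- (1 / \<gamma>))"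
        "\<bar>real_of_int x0 * \<xi>\<^sup>2 - real_of_int x2\<bar> \<le> c * X powr (- (1 / \<gamma>))"
      using sol by blast
    have "c * X powr (- (1 / \<gamma>)) = e (n0 + n)"
      by (simp add: X_def e_def golden_ratio_inverse powr_powr algebra_simps)
    then have er: "err \<xi> (x0, x1, x2) \<le> e (n0 + n)" using x by simp
    obtain g p where gp: "primitive p" "g \<noteq> 0" "(x0, x1, x2) = scale g p"
      using exists_primitive_divisor[OF x(1)] by blast
    have x0: "x0 \<noteq> 0"
    proof
      assume "x0 = 0"
      then have "\<bar>real_of_int x1\<bar> < 1" "\<bar>real_of_int x2\<bar> < 1"
        using er n0[of "n0 + n"] by auto
      then show False using x(1) \<open>x0 = 0\<close> by auto
    qed
    define s where "s = sgn (fst p)"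
    obtain p0 p1 p2 where p: "p = (p0, p1, p2)" by (cases p) auto
    have p0: "p0 \<noteq> 0" "x0 = g * p0" using x0 gp(3) p by auto
    have s: "s * s = 1" "s \<noteq> 0" "s * p0 = \<bar>p0\<bar>"
      using p0 by (auto simp: s_def p sgn_if)
    have sp: "scale s (scale s p) = p"
      using s(1) by (simp add: p flip: mult.assoc)
    have "primitive (scale s p)"
    proof -
      obtain u where "dot u p = 1" using gp(1) unfolding primitive_def by blast
      moreover have "dot (scale s u) (scale s p) = (s * s) * dot u p"
        by (cases u) (simp add: p algebra_simps)
      ultimately have "dot (scale s u) (scale s p) = 1" using s(1) by simp
      then show ?thesis unfolding primitive_def by blast
    qed
    moreover have "fst (scale s p) > 0" using p0 s by (simp add: p)
    moreover have "err \<xi> (scale s p) \<le> e (n0 + n)"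
      using err_le_scale[OF s(2), of \<xi> "scale s p"] err_le_scale[OF gp(2), of \<xi> p] gp(3) er sp by simp
    moreover have "real_of_int (fst (scale s p)) \<le> X"
      using abs_mult_int_ge[OF gp(2), of p0] x(2) p0 s(3) by (simp add: p)
    ultimately show ?thesis unfolding S_def X_def by blast
  qed
  have w: "S n (w n)" "\<And>x. S n x \<Longrightarrow> fst (w n) \<le> fst x" for n
  proof -
    obtain x where "S n x" using ex by blast
    then have *: "S n (w n)" "\<And>x. S n x \<Longrightarrow> nat (fst (w n)) \<le> nat (fst x)"
      using arg_min_nat_lemma[of "S n" x "\<lambda>x. nat (fst x)"] unfolding w_def by blast+
    show "S n (w n)" by (rule *)
    show "fst (w n) \<le> fst x" if "S n x" for x using *(2)[OF that] that by (auto simp: S_def)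
  qed
  have "approximating_sequence \<xi> (2 powr real n0) c w"
  proof
    fix n
    show "primitive (w n)" "fst (w n) > 0" using w(1)[of n] by (auto simp: S_def)
    show "err \<xi> (w n) \<le> c * 2 powr (- (\<gamma> - 1) * real n)"
      using w(1)[of n] e_mono[of n "n0 + n"] by (auto simp: S_def e_def)
    have "S n (w (Suc n))"
      using w(1)[of "Suc n"] e_mono[of "n0 + n" "n0 + Suc n"] by (auto simp: S_def)
    then show "fst (w n) \<le> fst (w (Suc n))" by (rule w(2))
    obtain x where "S n x" "real_of_int (fst x) \<le> 2 powr real (n0 + n)" using ex by blast
    then have "real_of_int (fst (w n)) \<le> 2 powr real (n0 + n)" using w(2)[of n x] by linarith
    then show "real_of_int (fst (w n)) \<le> 2 powr real n0 * 2 powr real n" by (simp add: powr_add)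
  qed (use c form_nonzero_of_extremal[OF assms] in auto)
  then show thesis by (rule that)
qed

theorem theorem1p2:
  fixes \<xi> :: real
  assumes "extremal \<xi>"
  shows "\<exists>c > 0. \<forall>X \<ge> 1 :: real. \<exists>x0 x1 x2 :: int. (x0, x1, x2) \<noteq> (0, 0, 0) \<and>
    \<bar>real_of_int x0\<bar> \<le> X \<and> \<bar>real_of_int x1\<bar> \<le> X \<and>
    \<bar>real_of_int x0 * \<xi>\<^sup>2 + real_of_int x1 * \<xi> + real_of_int x2\<bar> \<le> c * X powr (- (\<gamma>\<^sup>2))"
proof -
  obtain A c w where "approximating_sequence \<xi> A c w"
    using extremal_imp_approximating_sequence[OF assms] .
  then interpret approximating_sequence \<xi> A c w .
  obtain K n0 where K: "K > 0" and small: "\<And>n. n \<ge> n0 \<Longrightarrow> \<exists>p. p \<noteq> (0, 0, 0) \<and>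
      height p \<le> K * 2 powr ((\<gamma> - 1) * real n) \<and> \<bar>form \<xi> p\<bar> \<le> K * 2 powr (- \<gamma> * real n)"
    using small_forms_dyadic by blast
  define X1 where "X1 = K * 2 powr ((\<gamma> - 1) * real n0)"
  define C where "C = max (X1 powr (\<gamma>\<^sup>2)) (K * 2 powr \<gamma> * K powr (\<gamma>\<^sup>2))"
  have X1: "X1 > 0" using K by (simp add: X1_def)
  have "\<exists>x0 x1 x2 :: int. (x0, x1, x2) \<noteq> (0, 0, 0) \<and>
    \<bar>real_of_int x0\<bar> \<le> X \<and> \<bar>real_of_int x1\<bar> \<le> X \<and>
    \<bar>real_of_int x0 * \<xi>\<^sup>2 + real_of_int x1 * \<xi> + real_of_int x2\<bar> \<le> C * X powr (- (\<gamma>\<^sup>2))"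
    if X: "X \<ge> 1" for X
  proof (cases "X \<le> X1")
    case True
    have "X powr (\<gamma>\<^sup>2) \<le> X1 powr (\<gamma>\<^sup>2)" using X True by (intro powr_mono2) auto
    then have "X powr (\<gamma>\<^sup>2) \<le> C" by (simp add: C_def)
    then have "1 \<le> C * X powr (- (\<gamma>\<^sup>2))" using X by (simp add: powr_minus field_simps)
    then show ?thesis using X by (intro exI[of _ 0] exI[of _ 1]) simp
  next
    case False
    \<comment> \<open>The real level at which the height bound equals \<open>X\<close>; rounding it down costs the factor
       \<open>2 powr \<gamma>\<close> in the value.\<close>
    define T where "T = log 2 (X / K) / (\<gamma> - 1)"
    define n where "n = nat \<lfloor>T\<rfloor>"
    have g: "\<gamma> > 1" using golden_ratio_gt by simp
    have T: "2 powr ((\<gamma> - 1) * T) = X / K" using K X g by (simp add: T_def)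
    have "2 powr ((\<gamma> - 1) * real n0) < 2 powr ((\<gamma> - 1) * T)"
      using False K unfolding T X1_def by (simp add: field_simps)
    then have "real n0 < T" using g by simp
    then have n: "n0 \<le> n" "real n \<le> T" "T < real n + 1" unfolding n_def by linarith+
    obtain p where p: "p \<noteq> (0, 0, 0)" "height p \<le> K * 2 powr ((\<gamma> - 1) * real n)"
        "\<bar>form \<xi> p\<bar> \<le> K * 2 powr (- \<gamma> * real n)"
      using small[OF n(1)] by blast
    have "K * 2 powr ((\<gamma> - 1) * real n) \<le> K * 2 powr ((\<gamma> - 1) * T)"
      using n g K by (intro mult_left_mono powr_mono) auto
    then have h: "height p \<le> X" using p(2) K unfolding T by simp
    have "\<gamma> * (T - 1) \<le> \<gamma> * real n" using n g by (intro mult_left_mono) auto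
    then have "2 powr (- \<gamma> * real n) \<le> 2 powr (\<gamma> - \<gamma> * T)"
      by (intro powr_mono) (auto simp: algebra_simps)
    also have "\<dots> = 2 powr \<gamma> * 2 powr (- (\<gamma> * T))" by (simp add: powr_diff powr_minus field_simps)
    also have "- (\<gamma> * T) = ((\<gamma> - 1) * T) * (- (\<gamma>\<^sup>2))"
      using golden_ratio_square unfolding power2_eq_square by algebra
    also have "2 powr \<dots> = (X / K) powr (- (\<gamma>\<^sup>2))" unfolding T[symmetric] by (simp add: powr_powr)
    also have "\<dots> = K powr (\<gamma>\<^sup>2) * X powr (- (\<gamma>\<^sup>2))"
      using K X by (simp add: powr_divide powr_minus field_simps)
    finally have "K * 2 powr (- \<gamma> * real n) \<le> (K * 2 powr \<gamma> * K powr (\<gamma>\<^sup>2)) * X powr (- (\<gamma>\<^sup>2))"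
      using K by (simp add: mult.assoc)
    also have "\<dots> \<le> C * X powr (- (\<gamma>\<^sup>2))" by (intro mult_right_mono) (auto simp: C_def)
    finally have f: "\<bar>form \<xi> p\<bar> \<le> C * X powr (- (\<gamma>\<^sup>2))" using p(3) by linarith
    obtain p0 p1 p2 where pp: "p = (p0, p1, p2)" by (cases p) auto
    show ?thesis
      using p(1) h f unfolding pp
      by (intro exI[of _ p2] exI[of _ p1] exI[of _ p0]) (auto simp: algebra_simps)
  qed
  moreover have "C > 0" using X1 by (simp add: C_def less_max_iff_disj)
  ultimately show ?thesis by blast
qed

end
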